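(* Let $n\in\mathbb{N}$, $n\geq 4$, and let $$a(n)=\begin{cases}\dfrac{1}{1+\cos\frac{\pi}{n}}, & \text{if } n \text{ is even},\\[2ex] \dfrac{1}{1+\cos\frac{2\pi}{n}}, & \text{if } n\text{ is odd}.\end{cases}$$ Then $$T_n(x)+2-\frac{x+2}{n^2}\,T_n'(x)-a(n)\,\frac{1-x}{n^2}\,\bigl(n^2-T_n'(x)\bigr)\geq 0\qquad\text{for all } x\in[-1,1].$$ The constant $a(n)$ is the best possible, in the sense that for any constant $a>a(n)$ the inequality obtained by replacing $a(n)$ by $a$ fails (i.e. is violated for some $x\in[-1,1]$). Equality in the displayed inequality is attained at $x=1$ and $x=-\cos\frac{\pi}{n}$ and at no other point of $[-1,1]$ if $n$ is even, and at $x=\pm1$ and $x=-\cos\frac{2\pi}{n}$ and at no other point of $[-1,1]$ if $n$ is odd.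
   Context: $T_n$ denotes the $n$-th Chebyshev polynomial of the first kind, i.e. the polynomial with $T_n(\cos\theta)=\cos n\theta$ for $\theta\in[0,\pi]$; $T_n'$ is its derivative. *)

theory Defs
  imports "HOL-Analysis.Analysis" "HOL-Computational_Algebra.Polynomial"
begin

definition chebyshev_T :: "nat \<Rightarrow> real poly" where
  "chebyshev_T n = (THE p. \<forall>\<theta>\<in>{0..pi}. poly p (cos \<theta>) = cos (real n * \<theta>))"

text \<open>The description above is proper: such a polynomial exists and is unique.\<close>

lemma chebyshev_T_exists:
  "\<exists>p :: real poly. \<forall>\<theta>. poly p (cos \<theta>) = cos (real n * \<theta>)"
proof (induction n rule: less_induct)
  case (less n)
  consider "n = 0" | "n = 1" | m where "n = Suc (Suc m)"
    by (cases n; cases "n - 1") auto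
  then show ?case
  proof cases
    case 1
    then show ?thesis by (intro exI[of _ 1]) simp
  next
    case 2
    then show ?thesis by (intro exI[of _ "[:0, 1:]"]) simp
  next
    case 3
    have "m < n" and "Suc m < n" using 3 by simp_all
    from less[OF \<open>m < n\<close>] obtain p :: "real poly"
      where p: "\<And>\<theta>. poly p (cos \<theta>) = cos (real m * \<theta>)" by blast
    from less[OF \<open>Suc m < n\<close>] obtain q :: "real poly"
      where q: "\<And>\<theta>. poly q (cos \<theta>) = cos (real (Suc m) * \<theta>)" by blast
    have "poly (2 * [:0, 1:] * q - p) (cos \<theta>) = cos (real n * \<theta>)" for \<theta>
    proof -
      have "cos (real n * \<theta>) = cos (real (Suc m) * \<theta> + \<theta>)"
        by (simp add: 3 algebra_simps)
      moreover have "cos (real m * \<theta>) = cos (real (Suc m) * \<theta> - \<theta>)"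
        by (simp add: algebra_simps)
      ultimately show ?thesis
        by (simp add: p q cos_add[of "real (Suc m) * \<theta>" \<theta>]
            cos_diff[of "real (Suc m) * \<theta>" \<theta>] del: of_nat_Suc)
    qed
    then show ?thesis by blast
  qed
qed

lemma chebyshev_T_ex1:
  "\<exists>!p :: real poly. \<forall>\<theta>\<in>{0..pi}. poly p (cos \<theta>) = cos (real n * \<theta>)"
proof (rule ex_ex1I)
  show "\<exists>p :: real poly. \<forall>\<theta>\<in>{0..pi}. poly p (cos \<theta>) = cos (real n * \<theta>)"
    using chebyshev_T_exists by blast
next
  fix p q :: "real poly"
  assume p: "\<forall>\<theta>\<in>{0..pi}. poly p (cos \<theta>) = cos (real n * \<theta>)"
    and q: "\<forall>\<theta>\<in>{0..pi}. poly q (cos \<theta>) = cos (real n * \<theta>)"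
  have "poly (p - q) x = 0" if "x \<in> {-1..1}" for x
    using p[rule_format, of "arccos x"] q[rule_format, of "arccos x"] that
    by (simp add: arccos_lbound arccos_ubound)
  then have "{-1..1} \<subseteq> {x. poly (p - q) x = 0}" by blast
  then have "infinite {x. poly (p - q) x = 0}"
    using infinite_super infinite_Icc[of "-1 :: real" 1] by (metis less_numeral_extra(1) neg_less_0_iff_less less_trans)
  then have "p - q = 0"
    using poly_roots_finite by blast
  then show "p = q" by simp
qed

lemma poly_chebyshev_T_cos:
  "\<theta> \<in> {0..pi} \<Longrightarrow> poly (chebyshev_T n) (cos \<theta>) = cos (real n * \<theta>)"
  using theI'[OF chebyshev_T_ex1[of n]] unfolding chebyshev_T_def by blast

definition a_const :: "nat \<Rightarrow> real" where
  "a_const n = (if even n then 1 / (1 + cos (pi / real n))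
                else 1 / (1 + cos (2 * pi / real n)))"

definition cheb_expr :: "nat \<Rightarrow> real \<Rightarrow> real \<Rightarrow> real" where
  "cheb_expr n a x =
     poly (chebyshev_T n) x + 2
     - (x + 2) / (real n)\<^sup>2 * poly (pderiv (chebyshev_T n)) x
     - a * ((1 - x) / (real n)\<^sup>2) * ((real n)\<^sup>2 - poly (pderiv (chebyshev_T n)) x)"

end

theory Submission
  imports Defs "HOL-Real_Asymp.Real_Asymp"
begin

text \<open>
  Write $x = -\cos 2\varphi$, let $\alpha$ be $\pi/(2n)$ for even and $\pi/n$ for odd $n$, so that
  $-\cos 2\alpha$ is the interior zero, and put $\eta = n(\varphi - \alpha)$. In both parities
  $T_n(x) = -\cos 2\eta$ and $U = T_n'(x)/n^2 = \sin 2\eta / (n \sin 2\varphi)$, and the expression becomes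
  $1 - \cos 2\eta - 2U\sin^2\varphi + w(1-U)$ with $w = (\sin^2\varphi - \sin^2\alpha)/\cos^2\alpha$.
  With $p = \tan\varphi$ and $q = \tan\alpha$ it equals
  $w + 2\sin^2\eta - 2Y\sin\eta\cos\eta$ with $w = (p^2-q^2)/(1+p^2)$ and $Y = (3p^2-q^2)/(2np)$.
  For $|\eta| \le \pi/2$ (and $\varphi \ge \alpha/2$) the first-order terms of $w$ and $2Y\sin\eta\cos\eta$ at
  $\varphi = \alpha$ cancel, and the second-order remainder is absorbed by $2\sin^2\eta$. Farther to the
  right, $\cos 2\eta + Y\sin 2\eta \le \sqrt{1+Y^2} < 1 + w$ as long as
  $x \le \cos(\pi/n)$. For $x > \cos(\pi/n)$ Taylor bounds suffice, and close to $x = -1$ so do $|U| \le 1$ and the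
  smallness of $w$. At $-\cos 2\alpha$ the expression is $1 - a(1 + \cos 2\alpha)$ for any constant $a$, which
  shows that $a(n)$ is optimal.
\<close>

section \<open>Values of T_n, its derivative and the expression, endpoints included\<close>

lemma abs_sin_mult_le: "\<bar>sin (real n * x)\<bar> \<le> real n * \<bar>sin x\<bar>"
proof (induction n)
  case (Suc n)
  have "\<bar>sin (real (Suc n) * x)\<bar> = \<bar>sin (real n * x) * cos x + cos (real n * x) * sin x\<bar>"
    by (simp add: distrib_right sin_add algebra_simps)
  also have "\<dots> \<le> \<bar>sin (real n * x)\<bar> * \<bar>cos x\<bar> + \<bar>cos (real n * x)\<bar> * \<bar>sin x\<bar>"
    by (metis abs_mult abs_triangle_ineq)
  also have "\<dots> \<le> \<bar>sin (real n * x)\<bar> * 1 + 1 * \<bar>sin x\<bar>"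
    by (intro add_mono mult_left_mono mult_right_mono) auto
  finally show ?case using Suc by (simp add: algebra_simps)
qed simp

lemma poly_pderiv_chebyshev_T_cos:
  assumes "0 < \<theta>" "\<theta> < pi"
  shows "poly (pderiv (chebyshev_T n)) (cos \<theta>) = real n * sin (real n * \<theta>) / sin \<theta>"
proof -
  have "((\<lambda>t. poly (chebyshev_T n) (cos t)) has_real_derivative
          poly (pderiv (chebyshev_T n)) (cos \<theta>) * (- sin \<theta>)) (at \<theta>)"
    by (rule DERIV_chain2[OF poly_DERIV]) (auto intro!: derivative_eq_intros)
  moreover have "((\<lambda>t. poly (chebyshev_T n) (cos t)) has_real_derivative
          - sin (real n * \<theta>) * real n) (at \<theta>)"
  \<comment> \<open>T_n(cos t) = cos(n t) is available only for t in [0, pi], so the derivative is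
    transferred on the open interval.\<close>
  proof (rule has_field_derivative_transform_within_open[where S = "{0<..<pi}"])
    show "((\<lambda>t. cos (real n * t)) has_real_derivative - sin (real n * \<theta>) * real n) (at \<theta>)"
      by (auto intro!: derivative_eq_intros)
  qed (use assms poly_chebyshev_T_cos[of _ n] in auto)
  ultimately have "poly (pderiv (chebyshev_T n)) (cos \<theta>) * (- sin \<theta>) = - sin (real n * \<theta>) * real n"
    by (rule DERIV_unique)
  moreover have "sin \<theta> > 0" using assms by (rule sin_gt_zero)
  ultimately show ?thesis by (simp add: field_simps)
qed

lemma poly_chebyshev_T_1: "poly (chebyshev_T n) 1 = 1"
  using poly_chebyshev_T_cos[of 0 n] by simp

lemma poly_chebyshev_T_minus_1: "poly (chebyshev_T n) (- 1) = (- 1) ^ n"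
  using poly_chebyshev_T_cos[of pi n] by simp

text \<open>The sine quotient for the derivative degenerates to 0/0 at \<theta> = 0, so the value is
  obtained as a one-sided limit, using continuity of the polynomial.\<close>

lemma poly_pderiv_chebyshev_T_1: "poly (pderiv (chebyshev_T n)) 1 = (real n)\<^sup>2"
proof -
  let ?f = "\<lambda>t. poly (pderiv (chebyshev_T n)) (cos t)"
  have "isCont ?f 0" by (intro continuous_intros)
  then have "(?f \<longlongrightarrow> ?f 0) (at_right 0)"
    by (auto simp: isCont_def filterlim_at_split)
  moreover have "(?f \<longlongrightarrow> (real n)\<^sup>2) (at_right 0)"
  proof (rule Lim_transform_eventually)
    show "((\<lambda>t. real n * sin (real n * t) / sin t) \<longlongrightarrow> (real n)\<^sup>2) (at_right 0)"
      by (cases "n = 0") (auto, real_asymp simp: power2_eq_square)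
    show "\<forall>\<^sub>F t in at_right 0. real n * sin (real n * t) / sin t = ?f t"
      using eventually_at_right_real[of 0 pi]
      by (rule eventually_mono) (auto simp: poly_pderiv_chebyshev_T_cos)
  qed
  ultimately show ?thesis
    using tendsto_unique[OF trivial_limit_at_right_real] by fastforce
qed

text \<open>Reduced to the endpoint 1 by the reflection t -> pi - t, which multiplies the sine
  quotient by -(-1)^n; the identity passes to the limit t -> 0.\<close>

lemma poly_pderiv_chebyshev_T_minus_1:
  "poly (pderiv (chebyshev_T n)) (- 1) = - ((- 1) ^ n) * (real n)\<^sup>2"
proof -
  let ?f = "\<lambda>t. poly (pderiv (chebyshev_T n)) (- cos t)"
  let ?g = "\<lambda>t. - ((- 1) ^ n) * poly (pderiv (chebyshev_T n)) (cos t)"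
  have "isCont ?f 0" "isCont ?g 0" by (intro continuous_intros)+
  then have "(?f \<longlongrightarrow> ?f 0) (at_right 0)" "(?g \<longlongrightarrow> ?g 0) (at_right 0)"
    by (auto simp: isCont_def filterlim_at_split)
  note lim = this
  have "\<forall>\<^sub>F t in at_right 0. ?f t = ?g t"
    using eventually_at_right_real[of 0 pi]
  proof (rule eventually_mono)
    fix t :: real assume t: "t \<in> {0<..<pi}"
    have "?f t = poly (pderiv (chebyshev_T n)) (cos (pi - t))" by simp
    also have "\<dots> = real n * sin (real n * (pi - t)) / sin (pi - t)"
      using t by (intro poly_pderiv_chebyshev_T_cos) auto
    also have "sin (real n * (pi - t)) = - ((- 1) ^ n) * sin (real n * t)"
      by (simp add: right_diff_distrib sin_diff)
    finally show "?f t = ?g t"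
      using t by (simp add: poly_pderiv_chebyshev_T_cos)
  qed simp
  then have "(?g \<longlongrightarrow> ?f 0) (at_right 0)"
    by (rule Lim_transform_eventually[OF lim(1)])
  then have "?f 0 = ?g 0"
    using lim(2) by (intro tendsto_unique[OF trivial_limit_at_right_real])
  then show ?thesis by (simp add: poly_pderiv_chebyshev_T_1)
qed

lemma cheb_expr_1: "n > 0 \<Longrightarrow> cheb_expr n a 1 = 0"
  by (simp add: cheb_expr_def poly_chebyshev_T_1 poly_pderiv_chebyshev_T_1)

text \<open>For odd n this vanishes whatever \<open>a\<close> is, which makes -1 a zero; for even n
  it is 4 * (1 - a), so its sign depends on \<open>a\<close> < 1.\<close>

lemma cheb_expr_minus_1:
  "n > 0 \<Longrightarrow> cheb_expr n a (- 1) = 2 + 2 * (- 1) ^ n - 2 * a * (1 + (- 1) ^ n)"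
  by (simp add: cheb_expr_def poly_chebyshev_T_minus_1 poly_pderiv_chebyshev_T_minus_1 field_simps)

lemma cheb_expr_cos:
  fixes \<theta> :: real
  assumes "n > 0" "0 < \<theta>" "\<theta> < pi"
  defines "U \<equiv> sin (real n * \<theta>) / (real n * sin \<theta>)"
  shows "cheb_expr n a (cos \<theta>) = cos (real n * \<theta>) + 2 - (cos \<theta> + 2) * U - a * (1 - cos \<theta>) * (1 - U)"
proof -
  have "sin \<theta> > 0" using assms by (intro sin_gt_zero)
  with assms(1-3) show ?thesis
    unfolding U_def cheb_expr_def
    by (simp add: poly_chebyshev_T_cos poly_pderiv_chebyshev_T_cos) (simp add: field_simps power2_eq_square)
qed

section \<open>The expression in the variables \<phi> and \<eta>, and in tangents\<close>

text \<open>N and \<alpha> are independent reals here: the parity of n has disappeared, and on most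
  regions neither integrality of N nor the exact value of N * \<alpha> enters.\<close>

definition gap :: "real \<Rightarrow> real \<Rightarrow> real \<Rightarrow> real" where
  "gap N \<alpha> \<phi> = (let \<eta> = N * (\<phi> - \<alpha>); U = sin (2 * \<eta>) / (N * sin (2 * \<phi>));
     w = ((sin \<phi>)\<^sup>2 - (sin \<alpha>)\<^sup>2) / (cos \<alpha>)\<^sup>2
   in 1 - cos (2 * \<eta>) - 2 * U * (sin \<phi>)\<^sup>2 + w * (1 - U))"

text \<open>One statement for both parities: n * (pi - 2\<phi>) = k * pi - 2\<eta>, and oddness of k
  turns its cosine into -cos 2\<eta> and its sine into sin 2\<eta>. Since the constant is 1/(2 cos^2
  \<alpha>), the factor a(1 - x) equals 1 - w.\<close>

lemma cheb_expr_eq_gap: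
  assumes "odd k" "k \<le> n" "real n * \<alpha> = real (n - k) * pi / 2" "0 < \<alpha>" "\<alpha> < pi / 2" "0 < \<phi>" "\<phi> < pi / 2"
  shows "cheb_expr n (1 / (1 + cos (2 * \<alpha>))) (- cos (2 * \<phi>)) = gap (real n) \<alpha> \<phi>"
proof -
  define \<eta> where "\<eta> = real n * (\<phi> - \<alpha>)"
  define U where "U = sin (2 * \<eta>) / (real n * sin (2 * \<phi>))"
  define S where "S = (sin \<phi>)\<^sup>2"
  define C where "C = (cos \<alpha>)\<^sup>2"
  have n: "n > 0" using assms by (cases k) auto
  have th: "real n * (pi - 2 * \<phi>) = real k * pi - 2 * \<eta>"
    using assms(2,3) by (simp add: \<eta>_def algebra_simps of_nat_diff)
  have c: "cos (real n * (pi - 2 * \<phi>)) = - cos (2 * \<eta>)"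
    and s: "sin (real n * (pi - 2 * \<phi>)) = sin (2 * \<eta>)"
    unfolding th using assms(1) by (simp_all add: cos_diff sin_diff)
  have C: "C > 0" unfolding C_def using cos_gt_zero[of \<alpha>] assms by simp
  have "cheb_expr n (1 / (1 + cos (2 * \<alpha>))) (cos (pi - 2 * \<phi>))
     = - cos (2 * \<eta>) + 2 - (2 * S + 1) * U - 1 / (2 * C) * (2 - 2 * S) * (1 - U)"
    by (subst cheb_expr_cos)
      (use assms n in \<open>simp_all add: c s U_def S_def C_def cos_double_cos[of \<alpha>] cos_double_sin[of \<phi>]\<close>)
  also have "\<dots> = 1 - cos (2 * \<eta>) - 2 * U * S + (S - (1 - C)) / C * (1 - U)"
    using C by (simp add: field_simps)
  also have "1 - C = (sin \<alpha>)\<^sup>2" by (simp add: C_def sin_squared_eq)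
  finally show ?thesis
    by (simp only: gap_def Let_def \<eta>_def U_def S_def C_def cos_pi_minus)
qed

text \<open>The coefficient of -U is 2 sin^2 \<phi> + w = (3p^2 - q^2)/(1 + p^2), and 1/sin 2\<phi>
  = (1 + p^2)/(2p), so the factor 1 + p^2 cancels.\<close>

lemma gap_tan:
  assumes "N > 0" "0 < \<alpha>" "\<alpha> < pi / 2" "0 < \<phi>" "\<phi> < pi / 2"
  shows "gap N \<alpha> \<phi> = ((tan \<phi>)\<^sup>2 - (tan \<alpha>)\<^sup>2) / (1 + (tan \<phi>)\<^sup>2) + 2 * (sin (N * (\<phi> - \<alpha>)))\<^sup>2
    - sin (N * (\<phi> - \<alpha>)) * cos (N * (\<phi> - \<alpha>)) * ((3 * (tan \<phi>)\<^sup>2 - (tan \<alpha>)\<^sup>2) / (N * tan \<phi>))"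
proof -
  define p q where "p = tan \<phi>" and "q = tan \<alpha>"
  define \<eta> where "\<eta> = N * (\<phi> - \<alpha>)"
  have c: "cos \<phi> > 0" "cos \<alpha> > 0" using assms by (auto intro!: cos_gt_zero)
  have p: "p > 0" unfolding p_def using assms by (simp add: tan_gt_zero)
  have sec: "1 + p\<^sup>2 = 1 / (cos \<phi>)\<^sup>2" "1 + q\<^sup>2 = 1 / (cos \<alpha>)\<^sup>2"
    unfolding p_def q_def using c by (simp_all add: tan_sec power_inverse inverse_eq_divide power_divide)
  have S: "(sin \<phi>)\<^sup>2 = p\<^sup>2 / (1 + p\<^sup>2)" "(cos \<alpha>)\<^sup>2 = 1 / (1 + q\<^sup>2)" "(sin \<alpha>)\<^sup>2 = q\<^sup>2 / (1 + q\<^sup>2)"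
    "sin (2 * \<phi>) = 2 * p / (1 + p\<^sup>2)"
    unfolding sec unfolding p_def q_def using c
    by (simp_all add: tan_def power_divide sin_double power2_eq_square)
  define P Q where "P = 1 + p\<^sup>2" and "Q = 1 + q\<^sup>2"
  have PQ: "P > 0" "Q > 0" "p\<^sup>2 = P - 1" "q\<^sup>2 = Q - 1"
    by (simp_all add: P_def Q_def add_pos_nonneg)
  note S = S[folded P_def Q_def]
  have w: "((sin \<phi>)\<^sup>2 - (sin \<alpha>)\<^sup>2) / (cos \<alpha>)\<^sup>2 = (p\<^sup>2 - q\<^sup>2) / P"
    unfolding S unfolding PQ using PQ(1,2) by (simp add: field_simps)
  define U where "U = sin (2 * \<eta>) / (N * sin (2 * \<phi>))"
  have U: "U = sin \<eta> * cos \<eta> * P / (N * p)"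
    unfolding U_def S sin_double[of \<eta>] by simp
  have "gap N \<alpha> \<phi> = 2 * (sin \<eta>)\<^sup>2 - 2 * U * (p\<^sup>2 / P) + (p\<^sup>2 - q\<^sup>2) / P * (1 - U)"
    unfolding gap_def Let_def \<eta>_def[symmetric] U_def[symmetric] w unfolding S(1) cos_double_sin by simp
  also have "\<dots> = (p\<^sup>2 - q\<^sup>2) / P + 2 * (sin \<eta>)\<^sup>2 - U * (3 * p\<^sup>2 - q\<^sup>2) / P"
    using PQ(1) by (simp add: field_simps)
  also have "U * (3 * p\<^sup>2 - q\<^sup>2) / P = sin \<eta> * cos \<eta> * ((3 * p\<^sup>2 - q\<^sup>2) / (N * p))"
    unfolding U using PQ(1) by simp
  finally show ?thesis by (simp only: p_def q_def \<eta>_def P_def)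
qed

section \<open>Elementary inequalities for tangent and sine\<close>

text \<open>Mean value theorem: the derivative 1 + tan^2 is increasing on [0, pi/2).\<close>

lemma tan_diff_bounds:
  fixes a b :: real
  assumes "0 \<le> a" "a \<le> b" "b < pi / 2"
  shows "(b - a) * (1 + (tan a)\<^sup>2) \<le> tan b - tan a" "tan b - tan a \<le> (b - a) * (1 + (tan b)\<^sup>2)"
proof -
  have "(b - a) * (1 + (tan a)\<^sup>2) \<le> tan b - tan a \<and> tan b - tan a \<le> (b - a) * (1 + (tan b)\<^sup>2)"
  proof (cases "a = b")
    case False
    have c: "cos x > 0" if "a \<le> x" "x \<le> b" for x
      using that assms by (intro cos_gt_zero_pi) auto
    obtain z where z: "a < z" "z < b" "tan b - tan a = (b - a) * inverse ((cos z)\<^sup>2)"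
      using MVT2[of a b tan "\<lambda>x. inverse ((cos x)\<^sup>2)"] False assms(2) c
      by (metis DERIV_tan less_irrefl order_le_less)
    have "inverse ((cos z)\<^sup>2) = 1 + (tan z)\<^sup>2"
      using c[of z] z by (simp add: tan_sec power_inverse)
    moreover have "0 \<le> tan a" "tan a \<le> tan z" "tan z \<le> tan b"
      using z assms by (auto intro!: tan_mono_le tan_pos_pi2_le)
    ultimately show ?thesis
      using z(3) assms(2) by (auto intro!: mult_left_mono power_mono)
  qed simp
  then show "(b - a) * (1 + (tan a)\<^sup>2) \<le> tan b - tan a" "tan b - tan a \<le> (b - a) * (1 + (tan b)\<^sup>2)"
    by simp_all
qed

text \<open>This is x \<le> tan x with the denominator cleared, which keeps the endpoint pi/2
  available.\<close>

lemma mult_cos_le_sin: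
  fixes x :: real
  assumes "0 \<le> x" "x \<le> pi / 2"
  shows "x * cos x \<le> sin x"
proof (cases "x = pi / 2")
  case False
  then have "x < pi / 2" using assms by simp
  then have "cos x > 0" and "x \<le> tan x"
    using assms abs_tan_ge[of x] tan_pos_pi2_le[of x] by (auto intro!: cos_gt_zero_pi)
  then show ?thesis by (simp add: tan_def field_simps)
next
  case True
  have "pi / 2 * cos (pi / 2) \<le> sin (pi / 2)" by simp
  then show ?thesis by (simp only: True)
qed

section \<open>Positivity of \<open>gap\<close>, region by region\<close>

text \<open>The bound p - q \<ge> (\<eta>/N)(1 + q^2) gives w \<ge> \<eta> W/N, while (3p^2 - q^2)/p
  splits exactly into W + (p - q) L. The W parts compensate because s c \<le> \<eta>; the remaining
  term is of second order and stays below 2 s^2.\<close>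

lemma gap_pos_right:
  assumes N: "N \<ge> 4" and \<alpha>: "0 < \<alpha>" "\<alpha> < \<phi>" and \<phi>: "\<phi> < pi / 2"
    and \<eta>: "N * (\<phi> - \<alpha>) \<le> pi / 2" and p: "(tan \<phi>)\<^sup>2 \<le> 3"
  shows "gap N \<alpha> \<phi> > 0"
proof -
  define p q \<eta> where "p = tan \<phi>" and "q = tan \<alpha>" and "\<eta> = N * (\<phi> - \<alpha>)"
  define s c where "s = sin \<eta>" and "c = cos \<eta>"
  define L where "L = 2 + q / p + (p + q)\<^sup>2 / (1 + p\<^sup>2)"
  define K where "K = (2 + q / p) * (1 + p\<^sup>2) + (p + q)\<^sup>2"
  define W where "W = (p + q) * (1 + q\<^sup>2) / (1 + p\<^sup>2)"
  have \<delta>: "\<phi> - \<alpha> = \<eta> / N" using N by (simp add: \<eta>_def)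
  have \<eta>': "0 < \<eta>" "\<eta> \<le> pi / 2" using N \<alpha> \<eta> by (simp_all add: \<eta>_def)
  have q: "0 < q" unfolding q_def using \<alpha> \<phi> by (simp add: tan_gt_zero)
  have p': "0 < p" unfolding p_def using \<alpha> \<phi> by (simp add: tan_gt_zero)
  have pq: "q < p" unfolding p_def q_def using \<alpha> \<phi> by (intro tan_monotone) auto
  have d: "\<eta> / N * (1 + q\<^sup>2) \<le> p - q" "p - q \<le> \<eta> / N * (1 + p\<^sup>2)"
    using tan_diff_bounds[of \<alpha> \<phi>] \<alpha> \<phi> by (simp_all add: p_def q_def \<delta>)
  have s: "0 < s" "s \<le> \<eta>" unfolding s_def using \<eta>' by (auto intro!: sin_gt_zero sin_x_le_x)
  have c: "0 \<le> c" "c \<le> 1" unfolding c_def using \<eta>' by (auto intro!: cos_ge_zero)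
  have cs: "\<eta> * c \<le> s" unfolding c_def s_def using \<eta>' by (intro mult_cos_le_sin) auto
  have pp: "1 + p\<^sup>2 > 0" by (simp add: add_pos_nonneg)
  have L0: "0 \<le> L" "0 \<le> K" "0 \<le> W" unfolding L_def K_def W_def using q p' by simp_all
  have KL: "(1 + p\<^sup>2) * L = K" unfolding L_def K_def using pp by (simp add: distrib_left mult.commute)
  have sc: "s * c \<le> \<eta>" using mult_mono[OF s(2) c(2)] s c by simp
  have w: "s * c / N * W \<le> (p\<^sup>2 - q\<^sup>2) / (1 + p\<^sup>2)"
  proof -
    have "s * c / N * W \<le> \<eta> / N * W" using sc N L0 by (intro mult_right_mono divide_right_mono) auto
    also have "\<dots> = \<eta> / N * (1 + q\<^sup>2) * ((p + q) / (1 + p\<^sup>2))" by (simp add: W_def)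
    also have "\<dots> \<le> (p - q) * ((p + q) / (1 + p\<^sup>2))" using d p' q by (intro mult_right_mono) auto
    also have "\<dots> = (p\<^sup>2 - q\<^sup>2) / (1 + p\<^sup>2)" by (simp add: power2_eq_square algebra_simps)
    finally show ?thesis .
  qed
  have Q: "(3 * p\<^sup>2 - q\<^sup>2) / p = W + (p - q) * L"
  proof -
    define P where "P = 1 + p\<^sup>2"
    have "W = (p + q) * (P - (p\<^sup>2 - q\<^sup>2)) / P" by (simp add: W_def P_def)
    also have "\<dots> = (p + q) - (p + q) * (p\<^sup>2 - q\<^sup>2) / P"
      using pp by (simp add: P_def[symmetric] right_diff_distrib diff_divide_distrib)
    also have "(p + q) * (p\<^sup>2 - q\<^sup>2) / P = (p - q) * ((p + q)\<^sup>2 / P)"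
      by (simp add: power2_eq_square algebra_simps)
    finally have "W + (p - q) * L = p + q + (p - q) * (2 + q / p)"
      by (simp add: L_def P_def algebra_simps)
    then show ?thesis using p' by (simp add: field_simps power2_eq_square)
  qed
  have K: "K < 2 * N\<^sup>2"
  proof -
    have "q / p \<le> 1" using pq p' by simp
    \<comment> \<open>With p^2 \<le> 3 this is at most 12 + 12 = 24, while N \<ge> 4 gives 2 N^2
      \<ge> 32.\<close>
    then have "K \<le> 3 * (1 + p\<^sup>2) + (2 * p)\<^sup>2"
      unfolding K_def using pq p' q by (intro add_mono mult_right_mono power_mono) auto
    also have "\<dots> \<le> 24" using p by (simp add: p_def power_mult_distrib)
    also have "\<dots> < 2 * N\<^sup>2" using power_mono[OF N, of 2] by simp
    finally show ?thesis .
  qed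
  have "s * c * ((p - q) * L) / N \<le> s * c * (\<eta> / N * (1 + p\<^sup>2) * L) / N"
    using d(2) L0 s c N by (intro divide_right_mono mult_left_mono mult_right_mono) auto
  also have "\<dots> = s * (\<eta> * c) * (K / N\<^sup>2)"
    by (simp add: KL[symmetric] power2_eq_square)
  \<comment> \<open>Here \<eta> c \<le> s turns the remainder into a multiple of s^2, comparable
    with 2 s^2.\<close>
  also have "\<dots> \<le> s * s * (K / N\<^sup>2)"
    using cs s L0 by (intro mult_right_mono mult_left_mono) auto
  also have "\<dots> < s * s * 2"
    using K N s by (intro mult_strict_left_mono) (auto simp: divide_less_eq)
  finally have main: "s * c * ((p - q) * L) / N < 2 * s\<^sup>2" by (simp add: power2_eq_square)
  have "s * c * ((3 * p\<^sup>2 - q\<^sup>2) / (N * p)) = s * c * ((3 * p\<^sup>2 - q\<^sup>2) / p) / N" by simp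
  also have "\<dots> = s * c / N * W + s * c * ((p - q) * L) / N"
    unfolding Q by (simp add: distrib_left add_divide_distrib)
  also have "\<dots> < (p\<^sup>2 - q\<^sup>2) / (1 + p\<^sup>2) + 2 * s\<^sup>2" using w main by simp
  finally show ?thesis
    using gap_tan[of N \<alpha> \<phi>] N \<alpha> \<phi> by (simp add: p_def q_def s_def c_def \<eta>_def)
qed

text \<open>With q \<le> 2p/3 one has w \<ge> (5/9) p^2/(1 + p^2) and Y^2 \<le> 9 p^2/(4 N^2). The
  hypothesis with 81 and 40 says precisely that 9/(4 N^2) < 10/(9(1 + p^2)), hence Y^2 < 2w.\<close>

lemma gap_pos_middle:
  assumes N: "N > 0" and \<alpha>: "0 < \<alpha>" "3 / 2 * \<alpha> \<le> \<phi>" and \<phi>: "\<phi> < pi / 2"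
    and p: "81 * (1 + (tan \<phi>)\<^sup>2) < 40 * N\<^sup>2"
  shows "gap N \<alpha> \<phi> > 0"
proof -
  define p q \<eta> where "p = tan \<phi>" and "q = tan \<alpha>" and "\<eta> = N * (\<phi> - \<alpha>)"
  define w Y where "w = (p\<^sup>2 - q\<^sup>2) / (1 + p\<^sup>2)" and "Y = (3 * p\<^sup>2 - q\<^sup>2) / (2 * (N * p))"
  have q: "0 < q" unfolding q_def using \<alpha> \<phi> by (simp add: tan_gt_zero)
  have p': "0 < p" unfolding p_def using \<alpha> \<phi> by (simp add: tan_gt_zero)
  have pp: "1 + p\<^sup>2 > 0" by (simp add: add_pos_nonneg)
  \<comment> \<open>Convexity of tan in the form q \<le> 2(p - q), using \<alpha> \<le> 2(\<phi> -
    \<alpha>).\<close>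
  have "q \<le> \<alpha> * (1 + q\<^sup>2)" using tan_diff_bounds(2)[of 0 \<alpha>] \<alpha> \<phi> by (simp add: q_def)
  also have "\<dots> \<le> 2 * ((\<phi> - \<alpha>) * (1 + q\<^sup>2))"
    unfolding mult.assoc[symmetric] using \<alpha> by (intro mult_right_mono) auto
  also have "\<dots> \<le> 2 * (p - q)" using tan_diff_bounds(1)[of \<alpha> \<phi>] \<alpha> \<phi> by (simp add: p_def q_def)
  finally have pq: "q \<le> 2 / 3 * p" by simp
  then have "q\<^sup>2 \<le> (2 / 3 * p)\<^sup>2" using q by (intro power_mono) auto
  then have q2: "q\<^sup>2 \<le> 4 / 9 * p\<^sup>2" by (simp add: power_mult_distrib power_divide)
  have w1: "5 / 9 * p\<^sup>2 / (1 + p\<^sup>2) \<le> w"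
    unfolding w_def using q2 pp by (intro divide_right_mono) auto
  moreover have "0 < 5 / 9 * p\<^sup>2 / (1 + p\<^sup>2)" using p' pp by simp
  ultimately have w0: "w > 0" by linarith
  have "Y \<le> 3 * p\<^sup>2 / (2 * (N * p))" unfolding Y_def using p' N by (intro divide_right_mono) auto
  also have "\<dots> = 3 * p / (2 * N)" using p' N by (simp add: power2_eq_square)
  finally have Y: "Y \<le> 3 * p / (2 * N)" .
  have "q\<^sup>2 \<le> 3 * p\<^sup>2" using q2 zero_le_power2[of p] by linarith
  then have Y0: "0 \<le> Y" unfolding Y_def using p' N by simp
  have "Y\<^sup>2 \<le> (3 * p / (2 * N))\<^sup>2" using Y Y0 by (intro power_mono) auto
  also have "\<dots> = p\<^sup>2 * (9 / (4 * N\<^sup>2))" by (simp add: power_divide power_mult_distrib)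
  also have "\<dots> < p\<^sup>2 * (10 / (9 * (1 + p\<^sup>2)))"
    using p p' pp N by (intro mult_strict_left_mono) (simp_all add: p_def[symmetric] frac_less_eq divide_less_eq less_divide_eq)
  also have "\<dots> = 2 * (5 / 9 * p\<^sup>2 / (1 + p\<^sup>2))" by simp
  also have "\<dots> \<le> 2 * w" using w1 by simp
  also have "\<dots> \<le> w\<^sup>2 + 2 * w" by simp
  finally have Yw: "1 + Y\<^sup>2 < (1 + w)\<^sup>2" by (simp add: power2_eq_square algebra_simps)
  \<comment> \<open>Lagrange's identity, which yields the bound sqrt(1 + Y^2) for cos 2\<eta> + Y
    sin 2\<eta> by dropping the second square.\<close>
  have "(a + Y * b)\<^sup>2 + (b - Y * a)\<^sup>2 = (1 + Y\<^sup>2) * (b\<^sup>2 + a\<^sup>2)" for a b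
    by (simp add: power2_eq_square algebra_simps)
  from this[of "cos (2 * \<eta>)" "sin (2 * \<eta>)"]
  have "(cos (2 * \<eta>) + Y * sin (2 * \<eta>))\<^sup>2 + (sin (2 * \<eta>) - Y * cos (2 * \<eta>))\<^sup>2 = 1 + Y\<^sup>2"
    by simp
  also have "\<dots> < (1 + w)\<^sup>2" using Yw by simp
  finally have "(cos (2 * \<eta>) + Y * sin (2 * \<eta>))\<^sup>2 < (1 + w)\<^sup>2"
    using zero_le_power2[of "sin (2 * \<eta>) - Y * cos (2 * \<eta>)"] by linarith
  then have "cos (2 * \<eta>) + Y * sin (2 * \<eta>) < 1 + w"
    by (rule power2_less_imp_less) (use w0 in simp)
  moreover have "cos (2 * \<eta>) = 1 - 2 * (sin \<eta>)\<^sup>2" by (rule cos_double_sin)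
  moreover have "Y * sin (2 * \<eta>) = sin \<eta> * cos \<eta> * ((3 * p\<^sup>2 - q\<^sup>2) / (N * p))"
    by (simp add: Y_def sin_double)
  moreover have "gap N \<alpha> \<phi> = w + 2 * (sin \<eta>)\<^sup>2 - sin \<eta> * cos \<eta> * ((3 * p\<^sup>2 - q\<^sup>2) / (N * p))"
    unfolding p_def q_def w_def \<eta>_def using N \<alpha> \<phi> by (intro gap_tan) auto
  ultimately show ?thesis by linarith
qed

text \<open>The sine form of the weight w has a denominator independent of the moving angle, so its
  numerator can be factored by the addition formulas.\<close>

lemma tan_sin_weight:
  fixes a b :: real
  assumes "cos a \<noteq> 0" "cos b \<noteq> 0"
  shows "((tan a)\<^sup>2 - (tan b)\<^sup>2) / (1 + (tan a)\<^sup>2) = ((sin a)\<^sup>2 - (sin b)\<^sup>2) / (cos b)\<^sup>2"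
proof -
  define A B where "A = (cos a)\<^sup>2" and "B = (cos b)\<^sup>2"
  have AB: "A > 0" "B > 0" using assms by (simp_all add: A_def B_def)
  have "((tan a)\<^sup>2 - (tan b)\<^sup>2) / (1 + (tan a)\<^sup>2) = ((1 - A) / A - (1 - B) / B) * A"
    using assms by (simp add: tan_sec power_inverse A_def B_def divide_inverse)
      (simp add: tan_def sin_squared_eq power_divide divide_inverse power_mult_distrib power_inverse)
  also have "\<dots> = (1 - A - (1 - B)) / B" using AB by (simp add: field_simps)
  finally show ?thesis by (simp add: A_def B_def sin_squared_eq)
qed

text \<open>Now \<eta> = -\<rho> and w < 0. The loss -w is at most 2q\<rho>/N, and (3p^2 - q^2)/p =
  2q - (q - p)(3 + q/p). What is left after the first-order terms cancel is at most (1 + 3/4) s^2,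
  less than the available 2 s^2.\<close>

lemma gap_pos_left:
  assumes N: "N \<ge> 4" and \<alpha>: "0 < \<alpha>" "\<alpha> \<le> pi / 4" "\<alpha> / 2 \<le> \<phi>" "\<phi> < \<alpha>"
    and \<rho>: "N * (\<alpha> - \<phi>) \<le> pi / 2"
  shows "gap N \<alpha> \<phi> > 0"
proof -
  define p q \<rho> where "p = tan \<phi>" and "q = tan \<alpha>" and "\<rho> = N * (\<alpha> - \<phi>)"
  define s c where "s = sin \<rho>" and "c = cos \<rho>"
  have \<delta>: "\<alpha> - \<phi> = \<rho> / N" using N by (simp add: \<rho>_def)
  have \<rho>': "0 < \<rho>" "\<rho> \<le> pi / 2" using N \<alpha> \<rho> by (simp_all add: \<rho>_def)
  have \<phi>: "0 < \<phi>" "\<phi> < pi / 2" and \<alpha>2: "\<alpha> < pi / 2" using \<alpha> by auto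
  have p': "0 < p" unfolding p_def using \<phi> by (simp add: tan_gt_zero)
  have pq: "p < q" unfolding p_def q_def using \<alpha> \<phi> by (intro tan_monotone) auto
  have q1: "q \<le> 1" unfolding q_def tan_45[symmetric] using \<alpha> by (intro tan_mono_le) auto
  have "q - p \<le> \<rho> / N * (1 + q\<^sup>2)"
    using tan_diff_bounds(2)[of \<phi> \<alpha>] \<alpha> \<phi> \<alpha>2 by (simp add: p_def q_def \<delta>)
  also have "\<dots> \<le> \<rho> / N * 2"
    using q1 pq p' \<rho>' N by (intro mult_left_mono) (auto simp: power_le_one)
  finally have d: "q - p \<le> 2 * (\<rho> / N)" by (simp add: mult.commute)
  have "\<phi> \<le> p" using abs_tan_ge[of \<phi>] \<phi> p' by (simp add: p_def)
  \<comment> \<open>This is where \<alpha>/2 \<le> \<phi> enters: q - p \<le> 2(\<alpha> - \<phi>)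
    \<le> 2\<phi> \<le> 2p.\<close>
  then have q3: "q \<le> 3 * p" using d \<alpha> by (simp add: \<delta>[symmetric])
  have s: "0 < s" unfolding s_def using \<rho>' by (auto intro!: sin_gt_zero)
  have c: "0 \<le> c" unfolding c_def using \<rho>' by (auto intro!: cos_ge_zero)
  have cs: "\<rho> * c \<le> s" unfolding c_def s_def using \<rho>' by (intro mult_cos_le_sin) auto
  have "(q\<^sup>2 - p\<^sup>2) / (1 + p\<^sup>2) = ((sin \<alpha>)\<^sup>2 - (sin \<phi>)\<^sup>2) / (cos \<alpha>)\<^sup>2"
    using tan_sin_weight[of \<phi> \<alpha>] cos_gt_zero[of \<phi>] cos_gt_zero[of \<alpha>] \<alpha> \<alpha>2 \<phi>
    by (simp add: p_def q_def diff_divide_distrib)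
  also have "(sin \<alpha>)\<^sup>2 - (sin \<phi>)\<^sup>2 = sin (\<alpha> + \<phi>) * sin (\<alpha> - \<phi>)"
  proof -
    have "sin (\<alpha> + \<phi>) * sin (\<alpha> - \<phi>) = (sin \<alpha>)\<^sup>2 * (cos \<phi>)\<^sup>2 - (cos \<alpha>)\<^sup>2 * (sin \<phi>)\<^sup>2"
      by (simp add: sin_add sin_diff power2_eq_square algebra_simps)
    then show ?thesis by (simp add: cos_squared_eq algebra_simps)
  qed
  \<comment> \<open>Monotonicity of sine up to 2\<alpha> \<le> pi/2; dividing by cos^2 \<alpha> then
    leaves 2 tan \<alpha>.\<close>
  also have "\<dots> \<le> sin (2 * \<alpha>) * (\<alpha> - \<phi>)"
    using \<alpha> \<phi> by (intro mult_mono sin_monotone_2pi_le sin_x_le_x sin_ge_zero) auto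
  then have "sin (\<alpha> + \<phi>) * sin (\<alpha> - \<phi>) / (cos \<alpha>)\<^sup>2 \<le> sin (2 * \<alpha>) * (\<alpha> - \<phi>) / (cos \<alpha>)\<^sup>2"
    by (intro divide_right_mono) auto
  also have "\<dots> = 2 * q * \<rho> / N"
    unfolding sin_double \<delta> q_def tan_def power2_eq_square by (simp add: mult.commute mult.left_commute)
  finally have w: "(q\<^sup>2 - p\<^sup>2) / (1 + p\<^sup>2) \<le> 2 * q / N * \<rho>" by simp
  have Q: "(3 * p\<^sup>2 - q\<^sup>2) / p = 2 * q - (q - p) * (3 + q / p)"
    using p' by (simp add: field_simps power2_eq_square)
  have "s * c * ((q - p) * (3 + q / p)) / N \<le> s * c * (2 * (\<rho> / N) * 6) / N"
    using d q3 p' pq s c N by (intro divide_right_mono mult_left_mono mult_mono) (auto simp: divide_le_eq)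
  also have "\<dots> = s * (\<rho> * c) * (12 / N\<^sup>2)" by (simp add: power2_eq_square)
  also have "\<dots> \<le> s * s * (12 / 16)"
    using cs s c \<rho>' N power_mono[OF N, of 2]
    by (intro mult_mono mult_left_mono) (auto simp: divide_le_eq)
  finally have m1: "s * c * ((q - p) * (3 + q / p)) / N \<le> 3 / 4 * s\<^sup>2" by (simp add: power2_eq_square)
  \<comment> \<open>Shows that \<rho> - s c is itself of order s^2, so the cancelled first-order
    terms cost only s^2: 2q/N \<le> 1/2 and \<rho> \<le> pi/2 < 2.\<close>
  have "\<rho> * (1 - s\<^sup>2) = \<rho> * c * c" by (simp add: s_def c_def power2_eq_square[symmetric] cos_squared_eq)
  also have "\<dots> \<le> s * c" using cs c by (intro mult_right_mono)
  finally have "\<rho> - s * c \<le> \<rho> * s\<^sup>2" by (simp add: algebra_simps)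
  then have "2 * q / N * (\<rho> - s * c) \<le> 2 * q / N * (\<rho> * s\<^sup>2)"
    using q1 p' pq N by (intro mult_left_mono) auto
  also have "\<dots> \<le> 2 * 1 / 4 * (2 * s\<^sup>2)"
    using q1 p' pq N \<rho>' pi_less_4 by (intro mult_mono divide_mono) auto
  finally have m2: "2 * q / N * (\<rho> - s * c) \<le> s\<^sup>2" by simp
  have "s * c * ((3 * p\<^sup>2 - q\<^sup>2) / (N * p)) = s * c * ((3 * p\<^sup>2 - q\<^sup>2) / p) / N" by simp
  also have "\<dots> = 2 * q / N * (s * c) - s * c * ((q - p) * (3 + q / p)) / N"
    unfolding Q by (simp add: right_diff_distrib diff_divide_distrib)
  also have "\<dots> \<ge> 2 * q / N * \<rho> - s\<^sup>2 - 3 / 4 * s\<^sup>2"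
    using m1 m2[unfolded right_diff_distrib] by linarith
  finally have "(q\<^sup>2 - p\<^sup>2) / (1 + p\<^sup>2) < 2 * s\<^sup>2 + s * c * ((3 * p\<^sup>2 - q\<^sup>2) / (N * p))"
    using w s zero_less_power[OF s, of 2] by linarith
  moreover have "N * (\<phi> - \<alpha>) = - \<rho>" by (simp add: \<rho>_def algebra_simps)
  ultimately show ?thesis
    using gap_tan[of N \<alpha> \<phi>] N \<alpha> \<alpha>2 \<phi>
    by (simp add: p_def q_def s_def c_def diff_divide_distrib)
qed

lemma sin_weight_bounds:
  fixes \<alpha> \<phi> :: real
  assumes "0 \<le> \<phi>" "\<phi> \<le> \<alpha>" "\<alpha> < pi / 2"
  shows "((sin \<phi>)\<^sup>2 - (sin \<alpha>)\<^sup>2) / (cos \<alpha>)\<^sup>2 \<le> 0"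
    and "- ((tan \<alpha>)\<^sup>2) \<le> ((sin \<phi>)\<^sup>2 - (sin \<alpha>)\<^sup>2) / (cos \<alpha>)\<^sup>2"
proof -
  have "(sin \<phi>)\<^sup>2 \<le> (sin \<alpha>)\<^sup>2"
    using assms by (intro power_mono sin_monotone_2pi_le sin_ge_zero) auto
  then show "((sin \<phi>)\<^sup>2 - (sin \<alpha>)\<^sup>2) / (cos \<alpha>)\<^sup>2 \<le> 0" by (simp add: divide_le_0_iff)
  show "- ((tan \<alpha>)\<^sup>2) \<le> ((sin \<phi>)\<^sup>2 - (sin \<alpha>)\<^sup>2) / (cos \<alpha>)\<^sup>2"
    by (simp add: tan_def power_divide diff_divide_distrib)
qed

text \<open>With 2\<eta> = 2N\<phi> - pi and cos(2N\<phi>) \<ge> 0, the value is at least 1 + w(1 +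
  U) \<ge> 1 - 2/3, as w \<ge> -tan^2 \<alpha> \<ge> -1/3.\<close>

lemma gap_pos_far_left_even:
  assumes N: "N = real n" "n \<ge> 4" "N * \<alpha> = pi / 2" and \<phi>: "0 < \<phi>" "\<phi> < \<alpha> / 2"
  shows "gap N \<alpha> \<phi> > 0"
proof -
  \<comment> \<open>This is the negative of the U inside \<open>gap\<close>, because the shift by pi
    reverses the sign of the sine.\<close>
  define U where "U = sin (2 * (N * \<phi>)) / (N * sin (2 * \<phi>))"
  define w where "w = ((sin \<phi>)\<^sup>2 - (sin \<alpha>)\<^sup>2) / (cos \<alpha>)\<^sup>2"
  have N0: "N \<ge> 4" using N by simp
  have \<alpha>: "\<alpha> = pi / 2 / N" using N N0 by (simp add: field_simps)
  have "pi / 2 / N \<le> pi / 2 / 4" using N0 by (intro divide_left_mono) auto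
  then have \<alpha>2: "\<alpha> \<le> pi / 8" unfolding \<alpha> by simp
  have "N * \<phi> < N * (\<alpha> / 2)" using \<phi> N0 by simp
  then have t: "0 < N * \<phi>" "N * \<phi> < pi / 4" using N(3) \<phi> N0 by simp_all
  have e: "2 * (N * (\<phi> - \<alpha>)) = 2 * (N * \<phi>) - pi" using N(3) by (simp add: right_diff_distrib)
  have sp: "sin (2 * \<phi>) > 0" using \<phi> \<alpha>2 by (intro sin_gt_zero) auto
  have "\<bar>sin (N * (2 * \<phi>))\<bar> \<le> N * \<bar>sin (2 * \<phi>)\<bar>" unfolding N(1) by (rule abs_sin_mult_le)
  then have U1: "U \<le> 1" unfolding U_def using sp N0 by (simp add: mult.left_commute divide_le_eq)
  have U0: "U \<ge> 0" unfolding U_def using sp N0 t by (auto intro!: divide_nonneg_nonneg sin_ge_zero)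
  have "tan \<alpha> \<le> tan (pi / 6)" "0 \<le> tan \<alpha>"
    using \<alpha>2 \<phi> by (auto intro!: tan_mono_le tan_pos_pi2_le)
  then have "(tan \<alpha>)\<^sup>2 \<le> (1 / sqrt 3)\<^sup>2" by (intro power_mono) (auto simp: tan_30)
  then have w: "w \<le> 0" "- (1 / 3) \<le> w"
    using sin_weight_bounds[of \<phi> \<alpha>] \<phi> \<alpha>2 by (simp_all add: w_def power_divide)
  have "- w * U \<le> - w * 1" using w U1 by (intro mult_left_mono) auto
  then have "w * (1 + U) \<ge> - (2 / 3)" using w by (simp add: distrib_left)
  moreover have "cos (2 * (N * \<phi>)) \<ge> 0" using t by (intro cos_ge_zero) auto
  moreover have "2 * U * (sin \<phi>)\<^sup>2 \<ge> 0" using U0 by simp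
  moreover have "gap N \<alpha> \<phi> = 1 + cos (2 * (N * \<phi>)) + 2 * U * (sin \<phi>)\<^sup>2 + w * (1 + U)"
    unfolding gap_def Let_def e by (simp add: U_def w_def cos_diff sin_diff)
  ultimately show ?thesis by linarith
qed

text \<open>Here \<open>gap\<close> tends to 0 as \<phi> -> 0, so every term is measured against
  sin^2 \<mu>: the main term is 2 sin^2 \<mu>, and the losses are at most 1/4 and 1 times sin^2
  \<mu>.\<close>

lemma gap_pos_far_left_odd:
  assumes N: "N = real n" "n \<ge> 4" "N * \<alpha> = pi" and \<phi>: "0 < \<phi>" "\<phi> < \<alpha> / 2"
  shows "gap N \<alpha> \<phi> > 0"
proof -
  define \<mu> where "\<mu> = N * \<phi>"
  define U where "U = sin (2 * \<mu>) / (N * sin (2 * \<phi>))"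
  define w where "w = ((sin \<phi>)\<^sup>2 - (sin \<alpha>)\<^sup>2) / (cos \<alpha>)\<^sup>2"
  have N0: "N \<ge> 4" using N by simp
  have \<alpha>: "\<alpha> = pi / N" using N N0 by (simp add: field_simps)
  have "pi / N \<le> pi / 4" using N0 by (intro divide_left_mono) auto
  then have \<alpha>2: "\<alpha> \<le> pi / 4" unfolding \<alpha> by simp
  have "N * \<phi> < N * (\<alpha> / 2)" using \<phi> N0 by simp
  then have t: "0 < \<mu>" "\<mu> < pi / 2" using N(3) \<phi> N0 by (simp_all add: \<mu>_def)
  have e: "2 * (N * (\<phi> - \<alpha>)) = 2 * \<mu> - 2 * pi" using N(3) by (simp add: right_diff_distrib \<mu>_def)
  have sp: "sin (2 * \<phi>) > 0" using \<phi> \<alpha>2 by (intro sin_gt_zero) auto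
  have s: "sin \<mu> > 0" "cos \<mu> > 0" using t by (auto intro!: sin_gt_zero cos_gt_zero)
  have cs: "\<mu> * cos \<mu> \<le> sin \<mu>" using t by (intro mult_cos_le_sin) auto
  have "\<bar>sin (N * (2 * \<phi>))\<bar> \<le> N * \<bar>sin (2 * \<phi>)\<bar>" unfolding N(1) by (rule abs_sin_mult_le)
  then have U1: "U \<le> 1" unfolding U_def \<mu>_def using sp N0 by (simp add: mult.left_commute divide_le_eq)
  \<comment> \<open>N sin 2\<phi> \<le> 2\<mu> gives U \<ge> sin \<mu> cos \<mu> / \<mu> \<ge> cos^2
    \<mu>, so 1 - U is of order sin^2 \<mu>.\<close>
  have "(cos \<mu>)\<^sup>2 * (N * sin (2 * \<phi>)) \<le> (cos \<mu>)\<^sup>2 * (N * (2 * \<phi>))"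
    using \<phi> N0 by (intro mult_left_mono sin_x_le_x) auto
  also have "\<dots> = 2 * cos \<mu> * (\<mu> * cos \<mu>)" by (simp add: \<mu>_def power2_eq_square)
  also have "\<dots> \<le> 2 * cos \<mu> * sin \<mu>" using cs s by (intro mult_left_mono) auto
  also have "\<dots> = sin (2 * \<mu>)" by (simp add: sin_double)
  finally have "(cos \<mu>)\<^sup>2 \<le> U" unfolding U_def using sp N0 by (simp add: le_divide_eq)
  then have U2: "1 - U \<le> (sin \<mu>)\<^sup>2" by (simp add: sin_squared_eq)
  have cp: "cos \<phi> > 0" using \<phi> \<alpha>2 by (intro cos_gt_zero) auto
  have "tan \<phi> \<le> tan (pi / 4)" "0 \<le> tan \<phi>"
    using \<alpha>2 \<phi> by (auto intro!: tan_mono_le tan_pos_pi2_le simp del: tan_45)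
  then have "(tan \<phi>)\<^sup>2 \<le> 1" by (simp add: tan_45 power_le_one)
  then have "\<phi> * (1 + (tan \<phi>)\<^sup>2) \<le> \<phi> * 2" using \<phi> by (intro mult_left_mono) auto
  moreover have "tan \<phi> \<le> \<phi> * (1 + (tan \<phi>)\<^sup>2)" using tan_diff_bounds(2)[of 0 \<phi>] \<phi> \<alpha>2 by simp
  ultimately have tp: "tan \<phi> \<le> 2 * \<phi>" by linarith
  have "2 * U * (sin \<phi>)\<^sup>2 = 2 * sin \<mu> * cos \<mu> / N * tan \<phi>"
    using sp N0 cp by (simp add: U_def sin_double tan_def power2_eq_square)
  also have "\<dots> \<le> 2 * sin \<mu> * cos \<mu> / N * (2 * \<phi>)" using tp s N0 by (intro mult_left_mono) auto
  also have "\<dots> = sin \<mu> * (\<mu> * cos \<mu>) * (4 / N\<^sup>2)" using N0 by (simp add: \<mu>_def power2_eq_square)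
  also have "\<dots> \<le> sin \<mu> * sin \<mu> * (4 / 16)"
    using cs s t N0 power_mono[OF N0, of 2]
    by (intro mult_mono mult_left_mono) (auto simp: divide_le_eq)
  finally have m1: "2 * U * (sin \<phi>)\<^sup>2 \<le> 1 / 4 * (sin \<mu>)\<^sup>2" by (simp add: power2_eq_square)
  have "tan \<alpha> \<le> tan (pi / 4)" "0 \<le> tan \<alpha>"
    using \<alpha>2 \<phi> by (auto intro!: tan_mono_le tan_pos_pi2_le simp del: tan_45)
  then have "(tan \<alpha>)\<^sup>2 \<le> 1" by (simp add: tan_45 power_le_one)
  then have w: "w \<le> 0" "- 1 \<le> w"
    using sin_weight_bounds[of \<phi> \<alpha>] \<phi> \<alpha>2 by (simp_all add: w_def)
  have "- w * (1 - U) \<le> 1 * (sin \<mu>)\<^sup>2" using w U1 U2 by (intro mult_mono) auto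
  moreover have "1 - cos (2 * \<mu>) = 2 * (sin \<mu>)\<^sup>2" by (simp add: cos_double_sin)
  moreover have "gap N \<alpha> \<phi> = 1 - cos (2 * \<mu>) - 2 * U * (sin \<phi>)\<^sup>2 + w * (1 - U)"
    unfolding gap_def Let_def e by (simp add: U_def w_def cos_diff sin_diff)
  moreover have "(sin \<mu>)\<^sup>2 > 0" using s by simp
  ultimately show ?thesis using m1 by linarith
qed

section \<open>Taylor bounds for sine and cosine\<close>

text \<open>Lagrange remainder, whose trigonometric factor is at least -1; the next three bounds
  arise in the same way from -1 or 1.\<close>

lemma cos_taylor_lower6: "x > 0 \<Longrightarrow> 1 - x\<^sup>2 / 2 + x ^ 4 / 24 - x ^ 6 / 720 \<le> cos x"
  for x :: real
proof -
  assume x: "x > 0"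
  obtain t where t: "cos x = (\<Sum>m<6. cos_coeff m * x ^ m) + (cos (t + 1/2 * real 6 * pi) / fact 6) * x ^ 6"
    using Maclaurin_cos_expansion2[OF x, of 6] by auto
  have "(- 1) * x ^ 6 \<le> cos (t + 1/2 * real 6 * pi) * x ^ 6" using x by (intro mult_right_mono) auto
  then show ?thesis unfolding t
    by (simp add: cos_coeff_def lessThan_nat_numeral lessThan_Suc fact_numeral)
qed

lemma cos_taylor_upper4: "x > 0 \<Longrightarrow> cos x \<le> 1 - x\<^sup>2 / 2 + x ^ 4 / 24"
  for x :: real
proof -
  assume x: "x > 0"
  obtain t where t: "cos x = (\<Sum>m<4. cos_coeff m * x ^ m) + (cos (t + 1/2 * real 4 * pi) / fact 4) * x ^ 4"
    using Maclaurin_cos_expansion2[OF x, of 4] by auto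
  have "cos (t + 1/2 * real 4 * pi) * x ^ 4 \<le> 1 * x ^ 4" using x by (intro mult_right_mono) auto
  then show ?thesis unfolding t
    by (simp add: cos_coeff_def lessThan_nat_numeral lessThan_Suc fact_numeral)
qed

lemma sin_taylor_upper9:
  "x > 0 \<Longrightarrow> sin x \<le> x - x ^ 3 / 6 + x ^ 5 / 120 - x ^ 7 / 5040 + x ^ 9 / 362880"
  for x :: real
proof -
  assume x: "x > 0"
  obtain t where t: "sin x = (\<Sum>m<9. sin_coeff m * x ^ m) + (sin (t + 1/2 * real 9 * pi) / fact 9) * x ^ 9"
    using Maclaurin_sin_expansion3[OF _ x, of 9] by auto
  have "sin (t + 1/2 * real 9 * pi) * x ^ 9 \<le> 1 * x ^ 9" using x by (intro mult_right_mono) auto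
  then show ?thesis unfolding t
    by (simp add: sin_coeff_def lessThan_nat_numeral lessThan_Suc fact_numeral)
qed

lemma sin_taylor_lower3: "x > 0 \<Longrightarrow> x - x ^ 3 / 6 \<le> sin x"
  for x :: real
proof -
  assume x: "x > 0"
  obtain t where t: "sin x = (\<Sum>m<3. sin_coeff m * x ^ m) + (sin (t + 1/2 * real 3 * pi) / fact 3) * x ^ 3"
    using Maclaurin_sin_expansion3[OF _ x, of 3] by auto
  have "(- 1) * x ^ 3 \<le> sin (t + 1/2 * real 3 * pi) * x ^ 3" using x by (intro mult_right_mono) auto
  then show ?thesis unfolding t
    by (simp add: sin_coeff_def lessThan_nat_numeral lessThan_Suc fact_numeral)
qed

section \<open>Quantitative Cusa inequalities and the neighbourhood of x = 1\<close>

text \<open>Cusa's inequality sin t / t < (2 + cos t)/3 with an explicit margin: the terms up to t^2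
  cancel, and t^4 has coefficient 1/24 - 3/120 = 1/60.\<close>

lemma cos_sin_taylor_gap:
  fixes t :: real
  assumes "t > 0"
  shows "t ^ 4 * (1 / 60 - t\<^sup>2 / 1260 - t ^ 4 / 120960) \<le> cos t + 2 - 3 * (sin t / t)"
proof -
  have "3 * (sin t / t) \<le> 3 * ((t - t ^ 3 / 6 + t ^ 5 / 120 - t ^ 7 / 5040 + t ^ 9 / 362880) / t)"
    using assms sin_taylor_upper9[OF assms] by (intro mult_left_mono divide_right_mono) auto
  also have "\<dots> = 3 - t\<^sup>2 / 2 + t ^ 4 / 40 - t ^ 6 / 1680 + t ^ 8 / 120960"
    using assms by (simp add: field_simps eval_nat_numeral)
  finally have "3 * (sin t / t) \<le> 3 - t\<^sup>2 / 2 + t ^ 4 / 40 - t ^ 6 / 1680 + t ^ 8 / 120960" .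
  moreover have "t ^ 4 * (1 / 60 - t\<^sup>2 / 1260 - t ^ 4 / 120960) = t ^ 4 / 60 - t ^ 6 / 1260 - t ^ 8 / 120960"
    by (simp add: right_diff_distrib flip: power_add)
  ultimately show ?thesis using cos_taylor_lower6[OF assms] by linarith
qed

text \<open>A converse to Cusa's inequality. The constant 1/20 exceeds 1/24 by enough that, after
  multiplying out the Taylor bounds, the slack x^5 (1 - x^2)/120 is nonnegative for x \<le>
  1.\<close>

lemma cusa_upper:
  fixes x :: real
  assumes "0 < x" "x \<le> 1"
  shows "x * (cos x + 2) / sin x \<le> 3 + x ^ 4 / 20"
proof -
  have x2: "x\<^sup>2 \<le> 1" using assms by (simp add: power_le_one)
  have s: "sin x > 0" using assms pi_gt3 by (intro sin_gt_zero) auto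
  have "x * (cos x + 2) \<le> x * (3 - x\<^sup>2 / 2 + x ^ 4 / 24)"
    using assms cos_taylor_upper4[of x] by (intro mult_left_mono) auto
  also have "\<dots> = (3 + x ^ 4 / 20) * (x - x ^ 3 / 6) - x ^ 5 / 120 * (1 - x\<^sup>2)"
    by (simp add: field_simps eval_nat_numeral)
  also have "\<dots> \<le> (3 + x ^ 4 / 20) * (x - x ^ 3 / 6)" using assms x2 by simp
  also have "\<dots> \<le> (3 + x ^ 4 / 20) * sin x"
    using assms sin_taylor_lower3[of x] by (intro mult_left_mono) auto
  finally show ?thesis using s by (simp add: divide_le_eq)
qed

text \<open>All terms are compared at order t^4, where t = n\<theta>. The Cusa margin is about
  t^4/60; replacing \<theta>(cos \<theta> + 2)/sin \<theta> by 3 costs (t/4)^4/20 = t^4/5120, and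
  the term with \<open>a\<close> costs (t^2/32)(t^2/6) = t^4/192.\<close>

lemma cheb_expr_pos_near_1:
  assumes n: "n \<ge> 4" and a: "a \<le> 1" and \<theta>: "0 < \<theta>" "real n * \<theta> \<le> pi"
  shows "cheb_expr n a (cos \<theta>) > 0"
proof -
  define t where "t = real n * \<theta>"
  define U where "U = sin t / (real n * sin \<theta>)"
  have N: "real n \<ge> 4" using n by simp
  have t: "0 < t" "t \<le> pi" using \<theta> n by (simp_all add: t_def)
  have \<theta>t: "\<theta> = t / real n" using n by (simp add: t_def)
  also have "\<dots> \<le> t / 4" using N t by (intro divide_left_mono) auto
  finally have \<theta>4: "\<theta> \<le> t / 4" .
  have \<theta>1: "\<theta> \<le> 1" using \<theta>4 t pi_less_4 by simp
  have s: "sin \<theta> > 0" using \<theta> \<theta>1 pi_gt3 by (intro sin_gt_zero) auto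
  have st: "sin t \<ge> 0" "sin t \<le> t" using t by (auto intro!: sin_ge_zero sin_x_le_x)
  have "\<bar>sin (real n * \<theta>)\<bar> \<le> real n * \<bar>sin \<theta>\<bar>" by (rule abs_sin_mult_le)
  then have U1: "U \<le> 1" using s n by (simp add: U_def t_def divide_le_eq)
  have "(cos \<theta> + 2) * U = sin t / t * (\<theta> * (cos \<theta> + 2) / sin \<theta>)"
    using t n by (simp add: U_def t_def)
  also have "\<dots> \<le> sin t / t * (3 + \<theta> ^ 4 / 20)"
    using cusa_upper[of \<theta>] \<theta> \<theta>1 st t by (intro mult_left_mono) auto
  also have "\<dots> = 3 * (sin t / t) + sin t / t * (\<theta> ^ 4 / 20)" by (simp add: algebra_simps)
  also have "\<dots> \<le> 3 * (sin t / t) + 1 * ((t / 4) ^ 4 / 20)"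
    using st t \<theta> \<theta>4 by (intro add_left_mono mult_mono divide_right_mono power_mono) auto
  finally have m1: "(cos \<theta> + 2) * U \<le> 3 * (sin t / t) + t ^ 4 / 5120" by (simp add: power_divide)
  have c: "1 - cos \<theta> \<le> t\<^sup>2 / 32"
  proof -
    have "1 - cos \<theta> = 2 * (sin (\<theta> / 2))\<^sup>2" using cos_double_sin[of "\<theta> / 2"] by simp
    also have "\<dots> \<le> 2 * (\<theta> / 2)\<^sup>2"
      using \<theta> \<theta>1 pi_gt3 by (intro mult_left_mono power_mono sin_x_le_x sin_ge_zero) auto
    also have "\<dots> \<le> 2 * (t / 4 / 2)\<^sup>2" using \<theta>4 \<theta> by (intro mult_left_mono power_mono) auto
    finally show ?thesis by (simp add: power_divide)
  qed
  have "1 - t\<^sup>2 / 6 \<le> sin t / t"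
    using sin_taylor_lower3[OF t(1)] t by (simp add: field_simps eval_nat_numeral)
  also have "\<dots> \<le> U" unfolding U_def
    using st s n t sin_x_le_x[of \<theta>] \<theta> by (intro divide_left_mono) (auto simp: t_def)
  finally have "1 - U \<le> t\<^sup>2 / 6" by simp
  then have "(1 - cos \<theta>) * (1 - U) \<le> t\<^sup>2 / 32 * (t\<^sup>2 / 6)"
    using c U1 by (intro mult_mono) auto
  moreover have "a * ((1 - cos \<theta>) * (1 - U)) \<le> 1 * ((1 - cos \<theta>) * (1 - U))"
    using U1 a by (intro mult_right_mono) auto
  ultimately have m2: "a * (1 - cos \<theta>) * (1 - U) \<le> t ^ 4 / 192" by (simp add: eval_nat_numeral)
  \<comment> \<open>The margin minus both losses decreases in t, so it only has to be positive at t
    = pi, checked with decimal bounds for pi^2 and pi^4.\<close>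
  have "t\<^sup>2 \<le> (3.1416)\<^sup>2" using t pi_approx by (intro power_mono) auto
  then have t2: "t\<^sup>2 \<le> 9.87" by (simp add: power2_eq_square)
  then have "(t\<^sup>2)\<^sup>2 \<le> (9.87)\<^sup>2" by (intro power_mono) auto
  then have "t ^ 4 \<le> 97.5" by (simp add: power2_eq_square eval_nat_numeral)
  with t2 have "0 < 1 / 60 - t\<^sup>2 / 1260 - t ^ 4 / 120960 - 1 / 5120 - 1 / 192" by simp
  then have "0 < t ^ 4 * (1 / 60 - t\<^sup>2 / 1260 - t ^ 4 / 120960 - 1 / 5120 - 1 / 192)"
    using t by simp
  then have m3: "t ^ 4 / 5120 + t ^ 4 / 192 < t ^ 4 * (1 / 60 - t\<^sup>2 / 1260 - t ^ 4 / 120960)"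
    by (simp add: algebra_simps)
  have "cheb_expr n a (cos \<theta>) = cos t + 2 - (cos \<theta> + 2) * U - a * (1 - cos \<theta>) * (1 - U)"
    unfolding t_def U_def using n \<theta> \<theta>1 pi_gt3 by (intro cheb_expr_cos) auto
  then show ?thesis using m1 m2 m3 cos_sin_taylor_gap[OF t(1)] by linarith
qed

section \<open>Covering the open interval by the regions\<close>

text \<open>N y = pi/2 for y = pi/(2N), and y \<le> 0.4 makes the cubic correction less than 3
  percent. The value 3/2 suffices for \<open>gap_pos_middle\<close>, since 40 * (3/2)^2 = 90 >
  81.\<close>

lemma sin_pi_over_lower:
  assumes "N \<ge> (4 :: real)"
  shows "3 / 2 \<le> N * sin (pi / (2 * N))"
proof -
  define y where "y = pi / (2 * N)"
  have "y \<le> pi / (2 * 4)" unfolding y_def using assms by (intro divide_left_mono) auto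
  then have y: "0 < y" "y \<le> 0.4" using assms pi_approx by (auto simp: y_def)
  have "y\<^sup>2 \<le> (0.4)\<^sup>2" using y by (intro power_mono) auto
  then have "0.97 \<le> 1 - y\<^sup>2 / 6" by (simp add: power2_eq_square)
  then have "0.97 * (N * y) \<le> (1 - y\<^sup>2 / 6) * (N * y)" using y assms by (intro mult_right_mono) auto
  also have "\<dots> = N * (y - y ^ 3 / 6)" by (simp add: algebra_simps eval_nat_numeral)
  also have "\<dots> \<le> N * sin y" using sin_taylor_lower3[OF y(1)] assms by (intro mult_left_mono) auto
  finally have "0.97 * (N * y) \<le> N * sin y" .
  moreover have "N * y = pi / 2" using assms by (simp add: y_def)
  ultimately show ?thesis using pi_approx by (simp add: y_def)
qed

lemma cheb_expr_pos:
  assumes n: "n \<ge> 4" and \<alpha>: "even n \<and> real n * \<alpha> = pi / 2 \<or> odd n \<and> real n * \<alpha> = pi"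
    and \<phi>: "0 < \<phi>" "\<phi> < pi / 2" "\<phi> \<noteq> \<alpha>"
  shows "cheb_expr n (1 / (1 + cos (2 * \<alpha>))) (- cos (2 * \<phi>)) > 0"
proof -
  define N where "N = real n"
  have N: "N \<ge> 4" using n by (simp add: N_def)
  \<comment> \<open>An odd n \<ge> 4 is at least 5, which is needed below to get \<phi> \<le>
    pi/3.\<close>
  have \<alpha>': "N * \<alpha> = pi / 2 \<and> even n \<or> N * \<alpha> = pi \<and> 5 \<le> n"
    using \<alpha> n by (cases "n = 4") (auto simp: N_def)
  have "N * \<alpha> > 0" using \<alpha>' pi_gt_zero by linarith
  then have \<alpha>0: "0 < \<alpha>" using N zero_less_mult_pos[of N \<alpha>] by linarith
  have \<alpha>4: "\<alpha> \<le> pi / 4"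
  proof -
    have "4 * \<alpha> \<le> N * \<alpha>" using N \<alpha>0 by (intro mult_right_mono) auto
    then show ?thesis using \<alpha>' pi_gt_zero by linarith
  qed
  have c: "1 + cos (2 * \<alpha>) \<ge> 1" using cos_ge_zero[of "2 * \<alpha>"] \<alpha>0 \<alpha>4 by simp
  \<comment> \<open>The condition N(pi - 2\<phi>) \<le> pi means x \<ge> cos(pi/n); only in that
    case is the expression estimated directly instead of through \<open>gap\<close>.\<close>
  consider "\<phi> < \<alpha> / 2" | "\<alpha> / 2 \<le> \<phi>" "\<phi> < \<alpha>" | "\<alpha> < \<phi>" "N * (\<phi> - \<alpha>) \<le> pi / 2"
    | "pi / 2 < N * (\<phi> - \<alpha>)" "N * (pi - 2 * \<phi>) \<le> pi" | "pi / 2 < N * (\<phi> - \<alpha>)" "pi \<le> N * (pi - 2 * \<phi>)"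
    using \<phi>(3) by linarith
  then consider "gap N \<alpha> \<phi> > 0" | "N * (pi - 2 * \<phi>) \<le> pi"
  proof cases
    case 1
    then show ?thesis
      using that(1) \<alpha>' \<phi> n gap_pos_far_left_even[OF N_def] gap_pos_far_left_odd[OF N_def] by blast
  next
    case 2
    have "N * (\<alpha> - \<phi>) \<le> pi / 2"
    proof -
      have "N * (\<alpha> - \<phi>) \<le> N * (\<alpha> / 2)" using 2 N by (intro mult_left_mono) auto
      moreover have "N * \<alpha> \<le> pi" using \<alpha>' pi_gt_zero by linarith
      ultimately show ?thesis by simp
    qed
    then show ?thesis using that(1) gap_pos_left[OF N \<alpha>0 \<alpha>4 2] by blast
  next
    case 3
    have "\<phi> \<le> pi / 3"
      using \<alpha>'
    proof
      assume a: "N * \<alpha> = pi / 2 \<and> even n"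
      have "4 * \<phi> \<le> N * \<phi>" using N \<phi> by (intro mult_right_mono) auto
      then show ?thesis using 3 a pi_gt3 by (simp add: right_diff_distrib)
    next
      assume a: "N * \<alpha> = pi \<and> 5 \<le> n"
      \<comment> \<open>N\<phi> \<le> 3pi/2, hence \<phi> \<le> 3pi/10 < pi/3; a factor 4 would give
        only 3pi/8.\<close>
      have "5 * \<phi> \<le> N * \<phi>" using a \<phi> by (intro mult_right_mono) (auto simp: N_def)
      then show ?thesis using 3 a pi_gt3 by (simp add: right_diff_distrib)
    qed
    then have "tan \<phi> \<le> tan (pi / 3)" "0 \<le> tan \<phi>" using \<phi> by (auto intro!: tan_mono_le tan_pos_pi2_le)
    then have "(tan \<phi>)\<^sup>2 \<le> (sqrt 3)\<^sup>2" by (intro power_mono) (auto simp: tan_60)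
    then have "(tan \<phi>)\<^sup>2 \<le> 3" by simp
    then show ?thesis using that(1) gap_pos_right[OF N \<alpha>0 3(1) \<phi>(2) 3(2)] by blast
  next
    case 4
    then show ?thesis using that(2) by blast
  next
    case 5
    have "N * \<alpha> \<le> pi" using \<alpha>' pi_gt_zero by linarith
    \<comment> \<open>N\<phi> exceeds N\<alpha> by more than pi/2, which is at least
      N\<alpha>/2.\<close>
    then have "N * (3 / 2 * \<alpha>) \<le> N * \<phi>" using 5(1) by (simp add: right_diff_distrib)
    then have a: "3 / 2 * \<alpha> \<le> \<phi>" using N by simp
    have "pi / (2 * N) \<le> pi / 2 - \<phi>" using 5(2) N by (simp add: field_simps)
    then have "sin (pi / (2 * N)) \<le> sin (pi / 2 - \<phi>)"
      using N \<phi> by (intro sin_monotone_2pi_le) (auto intro: order_trans[of _ 0])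
    also have "\<dots> = cos \<phi>" by (simp add: sin_diff)
    finally have "N * sin (pi / (2 * N)) \<le> N * cos \<phi>" using N by (intro mult_left_mono) auto
    then have "3 / 2 \<le> N * cos \<phi>" using sin_pi_over_lower[OF N] by linarith
    then have "(3 / 2)\<^sup>2 \<le> (N * cos \<phi>)\<^sup>2" by (intro power_mono) auto
    then have Nc: "81 < 40 * N\<^sup>2 * (cos \<phi>)\<^sup>2" by (simp add: power2_eq_square algebra_simps)
    have cp: "cos \<phi> > 0" using \<phi> by (intro cos_gt_zero)
    have "81 * (1 + (tan \<phi>)\<^sup>2) = 81 / (cos \<phi>)\<^sup>2"
      using cp by (simp add: tan_sec power_inverse divide_inverse)
    also have "\<dots> < 40 * N\<^sup>2" using Nc cp by (simp add: divide_less_eq)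
    finally show ?thesis using that(1) gap_pos_middle[of N \<alpha> \<phi>] N \<alpha>0 a \<phi> by simp
  qed
  then show ?thesis
  proof cases
    case 1
    \<comment> \<open>The odd k with n - k = 1 or 2, matching n\<alpha> = pi/2 or pi.\<close>
    define k where "k = (if even n then n - 1 else n - 2)"
    have k: "odd k" "k \<le> n" using n by (auto simp: k_def)
    have "real n * \<alpha> = real (n - k) * pi / 2" using n \<alpha> by (auto simp: k_def)
    from cheb_expr_eq_gap[OF k this \<alpha>0 _ \<phi>(1,2)] show ?thesis
      using 1 \<alpha>4 \<alpha>0 by (simp add: N_def)
  next
    case 2
    have "cheb_expr n (1 / (1 + cos (2 * \<alpha>))) (cos (pi - 2 * \<phi>)) > 0"
      using 2 \<phi> c n by (intro cheb_expr_pos_near_1) (auto simp: N_def)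
    then show ?thesis by simp
  qed
qed

section \<open>Nonnegativity, optimality of the constant, and the equality cases\<close>

theorem theorem1p2:
  fixes n :: nat
  assumes "n \<ge> 4"
  shows "(\<forall>x\<in>{-1..1}. cheb_expr n (a_const n) x \<ge> 0) \<and>
         (\<forall>a > a_const n. \<exists>x\<in>{-1..1}. cheb_expr n a x < 0) \<and>
         (even n \<longrightarrow>
            {x\<in>{-1..1}. cheb_expr n (a_const n) x = 0} = {1, - cos (pi / real n)}) \<and>
         (odd n \<longrightarrow>
            {x\<in>{-1..1}. cheb_expr n (a_const n) x = 0} = {1, - 1, - cos (2 * pi / real n)})"
proof -
  define \<alpha> where "\<alpha> = (if even n then pi / (2 * real n) else pi / real n)"
  let ?E = "cheb_expr n (a_const n)"
  have n: "real n \<ge> 4" "n > 0" using assms by auto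
  have \<alpha>: "even n \<and> real n * \<alpha> = pi / 2 \<or> odd n \<and> real n * \<alpha> = pi"
    using n by (auto simp: \<alpha>_def)
  have "4 * \<alpha> \<le> real n * \<alpha>" using n by (intro mult_right_mono) (auto simp: \<alpha>_def)
  then have \<alpha>4: "\<alpha> \<le> pi / 4" using \<alpha> pi_gt_zero by linarith
  have \<alpha>0: "0 < \<alpha>" using n by (simp add: \<alpha>_def)
  have a: "a_const n = 1 / (1 + cos (2 * \<alpha>))" by (simp add: a_const_def \<alpha>_def)
  have c: "0 \<le> cos (2 * \<alpha>)" using \<alpha>0 \<alpha>4 by (intro cos_ge_zero) auto
  \<comment> \<open>For even n this makes a(n) < 1, so the value 4(1 - a(n)) at -1 is strictly
    positive and -1 is no zero.\<close>
  have ev: "cos (2 * \<alpha>) \<noteq> 0" if "even n"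
  proof -
    have "4 * (2 * \<alpha>) \<le> real n * (2 * \<alpha>)" using n \<alpha>0 by (intro mult_right_mono) auto
    moreover have "real n * (2 * \<alpha>) = pi" using \<alpha> that by simp
    ultimately have "2 * \<alpha> < pi / 2" using pi_gt_zero by linarith
    then show ?thesis using cos_gt_zero[of "2 * \<alpha>"] \<alpha>0 by auto
  qed
  have x0: "cheb_expr n b (- cos (2 * \<alpha>)) = 1 - b * (1 + cos (2 * \<alpha>))" for b
  proof -
    \<comment> \<open>n(pi - 2\<alpha>) is an odd multiple of pi in both parities, so U = 0 there
      and the expression is affine in b.\<close>
    have "cos (real n * (pi - 2 * \<alpha>)) = - 1" "sin (real n * (pi - 2 * \<alpha>)) = 0"
      using \<alpha> by (auto simp: right_diff_distrib cos_diff sin_diff mult.left_commute[of _ 2])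
    then have "cheb_expr n b (cos (pi - 2 * \<alpha>)) = 1 - b * (1 + cos (2 * \<alpha>))"
      using n \<alpha>0 \<alpha>4 by (subst cheb_expr_cos) simp_all
    then show ?thesis by simp
  qed
  have E0: "?E (- cos (2 * \<alpha>)) = 0" using c by (simp add: x0 a)
  have E1: "?E 1 = 0" using n by (simp add: cheb_expr_1)
  have Em: "if even n then ?E (- 1) > 0 else ?E (- 1) = 0"
    using n c ev by (auto simp: cheb_expr_minus_1 a divide_less_eq)
  have pos: "?E x > 0" if x: "- 1 < x" "x < 1" "x \<noteq> - cos (2 * \<alpha>)" for x
  proof -
    \<comment> \<open>Inverts x = -cos 2\<phi>; the strict bounds on x put \<phi> strictly between 0
      and pi/2.\<close>
    define \<phi> where "\<phi> = arccos (- x) / 2"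
    have "cos (2 * \<phi>) = - x" unfolding \<phi>_def using x by (simp add: cos_arccos)
    moreover have "0 < \<phi>" "\<phi> < pi / 2"
      using arccos_lt_bounded[of "- x"] x by (auto simp: \<phi>_def)
    moreover have "\<phi> \<noteq> \<alpha>" using calculation(1) x by auto
    ultimately show ?thesis using cheb_expr_pos[OF assms \<alpha>, of \<phi>] by (simp add: a)
  qed
  have cases: "x = - 1 \<or> x = 1 \<or> x = - cos (2 * \<alpha>) \<or> ?E x > 0" if "x \<in> {- 1..1}" for x
    using pos[of x] that by force
  have "?E x \<ge> 0" if "x \<in> {- 1..1}" for x
    using cases[OF that] E0 E1 Em by (auto split: if_splits)
  moreover have "\<exists>x\<in>{- 1..1}. cheb_expr n b x < 0" if "b > a_const n" for b
  proof (rule bexI)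
    show "cheb_expr n b (- cos (2 * \<alpha>)) < 0"
      using that c by (simp add: x0 a divide_less_eq)
  qed simp
  moreover have "{x \<in> {- 1..1}. ?E x = 0} = {1, - cos (2 * \<alpha>)}" if "even n"
    using cases E0 E1 Em that by fastforce
  moreover have "{x \<in> {- 1..1}. ?E x = 0} = {1, - 1, - cos (2 * \<alpha>)}" if "odd n"
    using cases E0 E1 Em that by fastforce
  ultimately show ?thesis by (auto simp: \<alpha>_def)
qed

end
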